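(* Let $(A,[-,-]_A,\omega,\beta)$ be a skew-symmetric quadratic Rota-Baxter Leibniz algebra of weight $\lambda\neq0$. Then there is a factorizable Leibniz bialgebra $(A,[-,-]_A,\Delta_r)$ with $\Delta_r(x)=F(x)r$ for $x\in A$, where $r\in A\otimes A$ is given through its operator form $T_r:A^*\to A$ by \[ T_r(a^* )=\beta\big((\omega^\sharp)^{-1}a^*\big),\qquad\forall a^*\in A^*. \]
   Context: All vector spaces and algebras are finite-dimensional over an algebraically closed field $\mathbb{K}$ of characteristic zero. A (left) Leibniz algebra is a vector space $A$ with a bilinear multiplication $[-,-]_A$ satisfying $[x,[y,z]_A]_A=[[x,y]_A,z]_A+[y,[x,z]_A]_A$. Define $\mathcal{L}_A(x)y=[x,y]_A=\mathcal{R}_A(y)x$, $\sigma(x\otimes y)=y\otimes x$, and $F(x)=(\mathcal{L}_A+\mathcal{R}_A)(x)\otimes\mathrm{id}-\mathrm{id}\otimes\mathcal{R}_A(x)\in\mathrm{End}(A\otimes A)$. A Leibniz bialgebra is a triple $(A,[-,-]_A,\Delta)$ where $(A,[-,-]_A)$ is a Leibniz algebra and $\Delta:A\to A\otimes A$ is linear with $(\Delta\otimes\mathrm{id})\Delta+(\sigma\otimes\mathrm{id})(\mathrm{id}\otimes\Delta)\Delta-(\mathrm{id}\otimes\Delta)\Delta=0$ and, for all $x,y\in A$, \[ \sigma(\mathcal{R}_A(y)\otimes\mathrm{id})\Delta(x)=(\mathcal{R}_A(x)\otimes\mathrm{id})\Delta(y), \] \[ \Delta([x,y]_A)=\big(\mathrm{id}\otimes\mathcal{R}_A(y)-(\mathcal{L}_A+\mathcal{R}_A)(y)\otimes\mathrm{id}\big)(\mathrm{id}+\sigma)\Delta(x)+\big(\mathrm{id}\otimes\mathcal{L}_A(x)+\mathcal{L}_A(x)\otimes\mathrm{id}\big)\Delta(y).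 \] For $r=\sum_i a_i\otimes b_i\in A\otimes A$ put $[[r,r]]=\sum_{i,j}\big([a_i,a_j]_A\otimes b_i\otimes b_j-a_i\otimes([b_i,a_j]_A+[a_j,b_i]_A)\otimes b_j+a_i\otimes a_j\otimes[b_j,b_i]_A\big)$; $r$ is a solution of the classical Leibniz Yang-Baxter equation (CLYBE) if $[[r,r]]=0$. If $r$ is a solution of the CLYBE and $F(x)(r-\sigma(r))=0$ for all $x\in A$, then $(A,[-,-]_A,\Delta_r)$ (which is then a Leibniz bialgebra) is called quasi-triangular; it is factorizable if moreover $T_{r-\sigma(r)}:A^*\to A$ is a linear isomorphism, where for $s\in A\otimes A$ the operator form $T_s:A^*\to A$ is given by $\langle T_s(a^* ),b^*\rangle=\langle s,a^*\otimes b^*\rangle$. A skew-symmetric quadratic Leibniz algebra $(A,[-,-]_A,\omega)$ is a Leibniz algebra with a nondegenerate skew-symmetric bilinear form $\omega$ such that $\omega(x,[y,z]_A)=\omega([x,z]_A+[z,x]_A,y)$ for all $x,y,z\in A$. The isomorphism $\omega^\sharp:A\to A^*$ is given by $\omega(x,y)=\langle\omega^\sharp(x),y\rangle$. A Rota-Baxter operator of weight $\lambda$ on $(A,[-,-]_A)$ is a linear map $\beta:A\to A$ with $[\beta(x),\beta(y)]_A=\beta([x,\beta(y)]_A+[\beta(x),y]_A+\lambda[x,y]_A)$. A skew-symmetric quadratic Rota-Baxter Leibniz algebra of weight $\lambda$ is a quadruple $(A,[-,-]_A,\omega,\beta)$ with $(A,[-,-]_A,\omega)$ a skew-symmetric quadratic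 Leibniz algebra and $\beta$ a Rota-Baxter operator of weight $\lambda$ on $(A,[-,-]_A)$ such that $\omega(\beta(x),y)+\omega(x,\beta(y))+\lambda\omega(x,y)=0$ for all $x,y\in A$. *)

theory Defs
  imports
    "HOL-Computational_Algebra.Polynomial"
    "HOL-Library.Function_Algebras"
begin

section \<open>Tensor powers of a vector space\<close>

text \<open>
  A tensor is represented by the multilinear function on linear functionals that it induces:
  \<open>a \<otimes> b\<close> is \<open>(f, g) \<mapsto> f a * g b\<close>.  The tensor square is the set of finite sums of such elements
  (over a field the canonical map from the algebraic tensor square to bilinear functions on the dual
  is injective; the universal property for finite dimension is \<open>tensor2_universal\<close> below).  All tensors are set to 0 outside the dual space, so
  that equality of tensors is equality of functions; sums, differences and 0 are pointwise.
\<close>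

locale vect = vector_space scale for scale :: "'a::field \<Rightarrow> 'b::ab_group_add \<Rightarrow> 'b"
begin

definition dual :: "('b \<Rightarrow> 'a) set" where
  "dual = {f. Vector_Spaces.linear scale (*) f}"

definition restr2 :: "(('b \<Rightarrow> 'a) \<Rightarrow> ('b \<Rightarrow> 'a) \<Rightarrow> 'a) \<Rightarrow> ('b \<Rightarrow> 'a) \<Rightarrow> ('b \<Rightarrow> 'a) \<Rightarrow> 'a" where
  "restr2 t = (\<lambda>f g. if f \<in> dual \<and> g \<in> dual then t f g else 0)"

definition restr3 :: "(('b \<Rightarrow> 'a) \<Rightarrow> ('b \<Rightarrow> 'a) \<Rightarrow> ('b \<Rightarrow> 'a) \<Rightarrow> 'a)
    \<Rightarrow> ('b \<Rightarrow> 'a) \<Rightarrow> ('b \<Rightarrow> 'a) \<Rightarrow> ('b \<Rightarrow> 'a) \<Rightarrow> 'a" where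
  "restr3 t = (\<lambda>f g h. if f \<in> dual \<and> g \<in> dual \<and> h \<in> dual then t f g h else 0)"

definition pure2 :: "'b \<Rightarrow> 'b \<Rightarrow> ('b \<Rightarrow> 'a) \<Rightarrow> ('b \<Rightarrow> 'a) \<Rightarrow> 'a" where
  "pure2 a b = restr2 (\<lambda>f g. f a * g b)"

definition pure3 :: "'b \<Rightarrow> 'b \<Rightarrow> 'b \<Rightarrow> ('b \<Rightarrow> 'a) \<Rightarrow> ('b \<Rightarrow> 'a) \<Rightarrow> ('b \<Rightarrow> 'a) \<Rightarrow> 'a" where
  "pure3 a b c = restr3 (\<lambda>f g h. f a * g b * h c)"

definition tensor2 :: "(('b \<Rightarrow> 'a) \<Rightarrow> ('b \<Rightarrow> 'a) \<Rightarrow> 'a) set" where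
  "tensor2 = {s. \<exists>(n::nat) a b. s = (\<Sum>i<n. pure2 (a i) (b i))}"

definition tscale :: "'a \<Rightarrow> (('b \<Rightarrow> 'a) \<Rightarrow> ('b \<Rightarrow> 'a) \<Rightarrow> 'a) \<Rightarrow> ('b \<Rightarrow> 'a) \<Rightarrow> ('b \<Rightarrow> 'a) \<Rightarrow> 'a" where
  "tscale c s = (\<lambda>f g. c * s f g)"

text \<open>\<open>flip2\<close> is \<open>\<sigma>\<close>, \<open>flip12\<close> is \<open>\<sigma> \<otimes> id\<close> on the tensor cube, \<open>map2 \<phi> \<psi>\<close> is \<open>\<phi> \<otimes> \<psi>\<close>,
  and \<open>comul_left D\<close>, \<open>comul_right D\<close> are \<open>D \<otimes> id\<close> and \<open>id \<otimes> D\<close> from the tensor square to the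
  tensor cube; their values on pure tensors are established below.\<close>

definition flip2 :: "(('b \<Rightarrow> 'a) \<Rightarrow> ('b \<Rightarrow> 'a) \<Rightarrow> 'a) \<Rightarrow> ('b \<Rightarrow> 'a) \<Rightarrow> ('b \<Rightarrow> 'a) \<Rightarrow> 'a" where
  "flip2 s = (\<lambda>f g. s g f)"

definition flip12 :: "(('b \<Rightarrow> 'a) \<Rightarrow> ('b \<Rightarrow> 'a) \<Rightarrow> ('b \<Rightarrow> 'a) \<Rightarrow> 'a)
    \<Rightarrow> ('b \<Rightarrow> 'a) \<Rightarrow> ('b \<Rightarrow> 'a) \<Rightarrow> ('b \<Rightarrow> 'a) \<Rightarrow> 'a" where
  "flip12 t = (\<lambda>f g h. t g f h)"

definition map2 :: "('b \<Rightarrow> 'b) \<Rightarrow> ('b \<Rightarrow> 'b) \<Rightarrow> (('b \<Rightarrow> 'a) \<Rightarrow> ('b \<Rightarrow> 'a) \<Rightarrow> 'a)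
    \<Rightarrow> ('b \<Rightarrow> 'a) \<Rightarrow> ('b \<Rightarrow> 'a) \<Rightarrow> 'a" where
  "map2 \<phi> \<psi> s = restr2 (\<lambda>f g. s (f \<circ> \<phi>) (g \<circ> \<psi>))"

definition comul_left :: "('b \<Rightarrow> ('b \<Rightarrow> 'a) \<Rightarrow> ('b \<Rightarrow> 'a) \<Rightarrow> 'a) \<Rightarrow> (('b \<Rightarrow> 'a) \<Rightarrow> ('b \<Rightarrow> 'a) \<Rightarrow> 'a)
    \<Rightarrow> ('b \<Rightarrow> 'a) \<Rightarrow> ('b \<Rightarrow> 'a) \<Rightarrow> ('b \<Rightarrow> 'a) \<Rightarrow> 'a" where
  "comul_left D s = restr3 (\<lambda>f g h. s (\<lambda>x. D x f g) h)"

definition comul_right :: "('b \<Rightarrow> ('b \<Rightarrow> 'a) \<Rightarrow> ('b \<Rightarrow> 'a) \<Rightarrow> 'a) \<Rightarrow> (('b \<Rightarrow> 'a) \<Rightarrow> ('b \<Rightarrow> 'a) \<Rightarrow> 'a)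
    \<Rightarrow> ('b \<Rightarrow> 'a) \<Rightarrow> ('b \<Rightarrow> 'a) \<Rightarrow> ('b \<Rightarrow> 'a) \<Rightarrow> 'a" where
  "comul_right D s = restr3 (\<lambda>f g h. s f (\<lambda>x. D x g h))"

text \<open>The operator form \<open>T\<^sub>s\<close>, determined by \<open>\<langle>T\<^sub>s f, g\<rangle> = \<langle>s, f \<otimes> g\<rangle>\<close> for all \<open>g\<close> in the dual.\<close>

definition op_form :: "(('b \<Rightarrow> 'a) \<Rightarrow> ('b \<Rightarrow> 'a) \<Rightarrow> 'a) \<Rightarrow> ('b \<Rightarrow> 'a) \<Rightarrow> 'b" where
  "op_form s f = (THE x. \<forall>g\<in>dual. g x = s f g)"

definition linear_iso_dual :: "(('b \<Rightarrow> 'a) \<Rightarrow> 'b) \<Rightarrow> bool" where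
  "linear_iso_dual T \<longleftrightarrow> bij_betw T dual UNIV
     \<and> (\<forall>f\<in>dual. \<forall>g\<in>dual. T (f + g) = T f + T g)
     \<and> (\<forall>c. \<forall>f\<in>dual. T (\<lambda>x. c * f x) = scale c (T f))"


subsection \<open>Adequacy\<close>

lemma sum_fun2: "(\<Sum>i\<in>I. t i) f g = (\<Sum>i\<in>I. t i f g)"
  for t :: "'i \<Rightarrow> 'x \<Rightarrow> 'y \<Rightarrow> 'z::comm_monoid_add"
  by (induction I rule: infinite_finite_induct) auto

lemma sum_fun3: "(\<Sum>i\<in>I. t i) f g h = (\<Sum>i\<in>I. t i f g h)"
  for t :: "'i \<Rightarrow> 'x \<Rightarrow> 'y \<Rightarrow> 'w \<Rightarrow> 'z::comm_monoid_add"
  by (induction I rule: infinite_finite_induct) auto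

lemma vector_space_field: "vector_space ((*) :: 'a \<Rightarrow> 'a \<Rightarrow> 'a)"
  by unfold_locales (auto simp: algebra_simps)

lemma dual_iff: "f \<in> dual \<longleftrightarrow> (\<forall>x y. f (x + y) = f x + f y) \<and> (\<forall>c x. f (scale c x) = c * f x)"
  unfolding dual_def
  by (auto simp: Vector_Spaces.linear_iff vector_space_field vector_space_axioms)

lemma dual_add: "f \<in> dual \<Longrightarrow> f (x + y) = f x + f y"
  and dual_scale: "f \<in> dual \<Longrightarrow> f (scale c x) = c * f x"
  by (auto simp: dual_iff)

lemma dual_0: "f \<in> dual \<Longrightarrow> f 0 = 0"
  using dual_scale[of f 0 0] by simp

lemma dual_sum: "f \<in> dual \<Longrightarrow> f (\<Sum>i\<in>I. v i) = (\<Sum>i\<in>I. f (v i))"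
  by (induction I rule: infinite_finite_induct) (auto simp: dual_0 dual_add)

lemma dual_separates:
  assumes "\<And>f. f \<in> dual \<Longrightarrow> f x = f y"
  shows "x = y"
proof (rule ccontr)
  assume "x \<noteq> y"
  hence ind: "independent {x - y}" by simp
  interpret vp: vector_space_pair scale "(*) :: 'a \<Rightarrow> 'a \<Rightarrow> 'a"
    by (intro vector_space_pair.intro vector_space_axioms vector_space_field)
  let ?f = "vp.construct {x - y} (\<lambda>_. 1)"
  have "?f \<in> dual" using vp.linear_construct[OF ind] by (simp add: dual_def)
  moreover have "?f (x - y) = 1" using vp.construct_basis[OF ind] by simp
  moreover have "?f x = ?f (x - y) + ?f y" using dual_add[OF \<open>?f \<in> dual\<close>, of "x - y" y] by simp
  ultimately show False using assms[OF \<open>?f \<in> dual\<close>] by simp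
qed

lemma pure2_add_left: "pure2 (a + a') b = pure2 a b + pure2 a' b"
  and pure2_add_right: "pure2 a (b + b') = pure2 a b + pure2 a b'"
  and pure2_scale_left: "pure2 (scale c a) b = tscale c (pure2 a b)"
  and pure2_scale_right: "pure2 a (scale c b) = tscale c (pure2 a b)"
  by (auto simp: pure2_def restr2_def tscale_def fun_eq_iff dual_add dual_scale algebra_simps)

lemma flip2_pure2: "flip2 (pure2 a b) = pure2 b a"
  and flip12_pure3: "flip12 (pure3 a b c) = pure3 b a c"
  by (auto simp: flip2_def flip12_def pure2_def pure3_def restr2_def restr3_def fun_eq_iff)

lemma map2_pure2:
  assumes "Vector_Spaces.linear scale scale \<phi>" "Vector_Spaces.linear scale scale \<psi>"
  shows "map2 \<phi> \<psi> (pure2 a b) = pure2 (\<phi> a) (\<psi> b)"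
proof -
  have "f \<circ> \<phi> \<in> dual" "f \<circ> \<psi> \<in> dual" if "f \<in> dual" for f
    using that assms by (auto simp: dual_iff Vector_Spaces.linear_iff)
  thus ?thesis by (auto simp: map2_def pure2_def restr2_def fun_eq_iff)
qed

lemma comul_pure2:
  assumes "Vector_Spaces.linear scale tscale D"
  shows comul_left_pure2: "f \<in> dual \<Longrightarrow> g \<in> dual \<Longrightarrow> h \<in> dual \<Longrightarrow>
            comul_left D (pure2 a b) f g h = D a f g * h b"
    and comul_right_pure2: "f \<in> dual \<Longrightarrow> g \<in> dual \<Longrightarrow> h \<in> dual \<Longrightarrow>
            comul_right D (pure2 a b) f g h = f a * D b g h"
proof -
  have "(\<lambda>x. D x f g) \<in> dual" for f g
    using assms by (auto simp: dual_iff Vector_Spaces.linear_iff tscale_def)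
  thus "f \<in> dual \<Longrightarrow> g \<in> dual \<Longrightarrow> h \<in> dual \<Longrightarrow>
            comul_left D (pure2 a b) f g h = D a f g * h b"
    and "f \<in> dual \<Longrightarrow> g \<in> dual \<Longrightarrow> h \<in> dual \<Longrightarrow>
            comul_right D (pure2 a b) f g h = f a * D b g h"
    by (auto simp: comul_left_def comul_right_def restr3_def pure2_def restr2_def)
qed

lemma op_form_sum_pure2:
  assumes "f \<in> dual"
  shows "op_form (\<Sum>i<(n::nat). pure2 (a i) (b i)) f = (\<Sum>i<n. scale (f (a i)) (b i))"
  unfolding op_form_def
proof (rule the_equality)
  show *: "\<forall>g\<in>dual. g (\<Sum>i<n. scale (f (a i)) (b i)) = (\<Sum>i<n. pure2 (a i) (b i)) f g"
    using assms by (simp add: sum_fun2 dual_sum dual_scale pure2_def restr2_def)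
  fix x assume "\<forall>g\<in>dual. g x = (\<Sum>i<n. pure2 (a i) (b i)) f g"
  thus "x = (\<Sum>i<n. scale (f (a i)) (b i))" using * by (intro dual_separates) simp
qed

lemma op_form_eq:
  assumes "s \<in> tensor2" "f \<in> dual" "g \<in> dual"
  shows "g (op_form s f) = s f g"
proof -
  obtain n :: nat and a b where s: "s = (\<Sum>i<n. pure2 (a i) (b i))"
    using assms(1) by (auto simp: tensor2_def)
  show ?thesis unfolding s op_form_sum_pure2[OF assms(2)] using assms(2,3)
    by (simp add: sum_fun2 dual_sum dual_scale pure2_def restr2_def)
qed

lemma op_form_inject:
  assumes "s \<in> tensor2" "t \<in> tensor2" "\<And>f. f \<in> dual \<Longrightarrow> op_form s f = op_form t f"
  shows "s = t"
proof (intro ext)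
  fix f g
  have "u f g = 0" if u: "u \<in> tensor2" and fg: "\<not> (f \<in> dual \<and> g \<in> dual)" for u
  proof -
    obtain n :: nat and a b where u: "u = (\<Sum>i<n. pure2 (a i) (b i))"
      using u by (auto simp: tensor2_def)
    show ?thesis unfolding u sum_fun2 using fg
      by (intro sum.neutral) (auto simp: pure2_def restr2_def)
  qed
  thus "s f g = t f g" using assms op_form_eq by metis
qed

end

lemma (in vect) tensor2_universal:
  fixes scaleV :: "'a \<Rightarrow> 'v::ab_group_add \<Rightarrow> 'v"
  assumes fd: "\<exists>Basis. finite_dimensional_vector_space scale Basis"
    and V: "vector_space scaleV"
    and l: "\<And>y. Vector_Spaces.linear scale scaleV (\<lambda>x. B x y)"
    and r: "\<And>x. Vector_Spaces.linear scale scaleV (B x)"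
    and eq: "(\<Sum>i<(n::nat). pure2 (a i) (b i)) = (\<Sum>i<(m::nat). pure2 (c i) (d i))"
  shows "(\<Sum>i<n. B (a i) (b i)) = (\<Sum>i<m. B (c i) (d i))"
proof -
  obtain Basis where "finite_dimensional_vector_space scale Basis" using fd by blast
  then interpret fd: finite_dimensional_vector_space scale Basis .
  note finite_Basis = fd.finite_Basis and independent_Basis = fd.independent_Basis
    and span_Basis = fd.span_Basis
  interpret V: vector_space scaleV by fact
  let ?r = "representation Basis"
  have rep: "x = (\<Sum>e\<in>Basis. scale (?r x e) e)" for x
    using sum_representation_eq[OF independent_Basis _ finite_Basis subset_refl, of x]
    by (simp add: span_Basis)
  have d: "(\<lambda>x. ?r x e) \<in> dual" for e
    by (auto simp: dual_iff representation_add[OF independent_Basis] representation_scale[OF independent_Basis]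
        span_Basis)
  have L: "B (\<Sum>e\<in>Basis. scale (p e) e) y = (\<Sum>e\<in>Basis. scaleV (p e) (B e y))" for p y
    by (simp add: module_hom.sum[OF l[unfolded module_hom_iff_linear[symmetric]]]
        module_hom.scale[OF l[unfolded module_hom_iff_linear[symmetric]]])
  have R: "B x (\<Sum>e\<in>Basis. scale (p e) e) = (\<Sum>e\<in>Basis. scaleV (p e) (B x e))" for p x
    by (simp add: module_hom.sum[OF r[unfolded module_hom_iff_linear[symmetric]]]
        module_hom.scale[OF r[unfolded module_hom_iff_linear[symmetric]]])
  have B: "B x y = (\<Sum>e\<in>Basis. \<Sum>e'\<in>Basis. scaleV (?r x e * ?r y e') (B e e'))" for x y
  proof -
    have "B x y = (\<Sum>e\<in>Basis. scaleV (?r x e) (B e y))"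
      by (subst rep[of x]) (rule L)
    also have "\<dots> = (\<Sum>e\<in>Basis. scaleV (?r x e) (\<Sum>e'\<in>Basis. scaleV (?r y e') (B e e')))"
    proof (rule sum.cong[OF refl])
      fix e
      have "B e y = (\<Sum>e'\<in>Basis. scaleV (?r y e') (B e e'))" by (subst rep[of y]) (rule R)
      thus "scaleV (?r x e) (B e y) = scaleV (?r x e) (\<Sum>e'\<in>Basis. scaleV (?r y e') (B e e'))"
        by (rule arg_cong)
    qed
    finally show ?thesis by (simp add: V.scale_sum_right)
  qed
  have *: "(\<Sum>i<k. B (p i) (q i)) = (\<Sum>e\<in>Basis. \<Sum>e'\<in>Basis.
      scaleV ((\<Sum>i<k. pure2 (p i) (q i)) (\<lambda>x. ?r x e) (\<lambda>x. ?r x e')) (B e e'))"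
    for k :: nat and p q
  proof -
    have "(\<Sum>i<k. B (p i) (q i))
        = (\<Sum>i<k. \<Sum>e\<in>Basis. \<Sum>e'\<in>Basis. scaleV (?r (p i) e * ?r (q i) e') (B e e'))"
      by (rule sum.cong[OF refl], rule B)
    also have "\<dots> = (\<Sum>e\<in>Basis. \<Sum>i<k. \<Sum>e'\<in>Basis. scaleV (?r (p i) e * ?r (q i) e') (B e e'))"
      by (rule sum.swap)
    also have "\<dots> = (\<Sum>e\<in>Basis. \<Sum>e'\<in>Basis. \<Sum>i<k. scaleV (?r (p i) e * ?r (q i) e') (B e e'))"
      by (rule sum.cong[OF refl], rule sum.swap)
    finally show ?thesis by (simp add: sum_fun2 pure2_def restr2_def d V.scale_sum_left)
  qed
  show ?thesis unfolding * eq ..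
qed


section \<open>Leibniz algebras and bialgebras\<close>

text \<open>\<open>x \<cdot> y\<close> is the Leibniz bracket \<open>[x, y]\<close>.\<close>

locale leibniz_algebra = vect scale
  for scale :: "'k::{alg_closed_field, field_char_0} \<Rightarrow> 'a::ab_group_add \<Rightarrow> 'a" +
  fixes bracket :: "'a \<Rightarrow> 'a \<Rightarrow> 'a" (infixl "\<cdot>" 70)
  assumes finite_dim: "\<exists>Basis. finite_dimensional_vector_space scale Basis"
    and bracket_linear_left: "Vector_Spaces.linear scale scale (\<lambda>x. x \<cdot> y)"
    and bracket_linear_right: "Vector_Spaces.linear scale scale (\<lambda>y. x \<cdot> y)"
    and leibniz: "x \<cdot> (y \<cdot> z) = (x \<cdot> y) \<cdot> z + y \<cdot> (x \<cdot> z)"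
begin

definition Lm :: "'a \<Rightarrow> 'a \<Rightarrow> 'a" where "Lm x = (\<lambda>y. x \<cdot> y)"

definition Rm :: "'a \<Rightarrow> 'a \<Rightarrow> 'a" where "Rm x = (\<lambda>y. y \<cdot> x)"

definition Fop :: "'a \<Rightarrow> (('a \<Rightarrow> 'k) \<Rightarrow> ('a \<Rightarrow> 'k) \<Rightarrow> 'k) \<Rightarrow> ('a \<Rightarrow> 'k) \<Rightarrow> ('a \<Rightarrow> 'k) \<Rightarrow> 'k" where
  "Fop x s = map2 (Lm x + Rm x) id s - map2 id (Rm x) s"

definition leibniz_bialgebra :: "('a \<Rightarrow> ('a \<Rightarrow> 'k) \<Rightarrow> ('a \<Rightarrow> 'k) \<Rightarrow> 'k) \<Rightarrow> bool" where
  "leibniz_bialgebra \<Delta> \<longleftrightarrow>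
     Vector_Spaces.linear scale tscale \<Delta> \<and> range \<Delta> \<subseteq> tensor2 \<and>
     (\<forall>x. comul_left \<Delta> (\<Delta> x) + flip12 (comul_right \<Delta> (\<Delta> x)) - comul_right \<Delta> (\<Delta> x) = 0) \<and>
     (\<forall>x y. flip2 (map2 (Rm y) id (\<Delta> x)) = map2 (Rm x) id (\<Delta> y)) \<and>
     (\<forall>x y. \<Delta> (x \<cdot> y) =
        (map2 id (Rm y) (\<Delta> x + flip2 (\<Delta> x)) - map2 (Lm y + Rm y) id (\<Delta> x + flip2 (\<Delta> x)))
        + (map2 id (Lm x) (\<Delta> y) + map2 (Lm x) id (\<Delta> y)))"

text \<open>\<open>[[r, r]]\<close>; it does not depend on the chosen expression of \<open>r\<close> (\<open>clyb_sum_pure2\<close>).\<close>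

definition clyb :: "(('a \<Rightarrow> 'k) \<Rightarrow> ('a \<Rightarrow> 'k) \<Rightarrow> 'k) \<Rightarrow> ('a \<Rightarrow> 'k) \<Rightarrow> ('a \<Rightarrow> 'k) \<Rightarrow> ('a \<Rightarrow> 'k) \<Rightarrow> 'k" where
  "clyb r = (THE t. \<exists>(n::nat) a b. r = (\<Sum>i<n. pure2 (a i) (b i)) \<and>
     t = (\<Sum>i<n. \<Sum>j<n. pure3 (a i \<cdot> a j) (b i) (b j)
                       - pure3 (a i) (b i \<cdot> a j + a j \<cdot> b i) (b j)
                       + pure3 (a i) (a j) (b j \<cdot> b i)))"

definition clybe_solution :: "(('a \<Rightarrow> 'k) \<Rightarrow> ('a \<Rightarrow> 'k) \<Rightarrow> 'k) \<Rightarrow> bool" where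
  "clybe_solution r \<longleftrightarrow> r \<in> tensor2 \<and> clyb r = 0"

text \<open>\<open>\<Delta>\<^sub>r x = F(x) r\<close>. That \<open>\<Delta>\<^sub>r\<close> yields a Leibniz bialgebra follows from the other two conditions
  in \<open>quasi_triangular\<close>, but is part of the notion.\<close>

definition cobracket :: "(('a \<Rightarrow> 'k) \<Rightarrow> ('a \<Rightarrow> 'k) \<Rightarrow> 'k) \<Rightarrow> 'a \<Rightarrow> ('a \<Rightarrow> 'k) \<Rightarrow> ('a \<Rightarrow> 'k) \<Rightarrow> 'k" where
  "cobracket r x = Fop x r"

definition quasi_triangular :: "(('a \<Rightarrow> 'k) \<Rightarrow> ('a \<Rightarrow> 'k) \<Rightarrow> 'k) \<Rightarrow> bool" where
  "quasi_triangular r \<longleftrightarrow> clybe_solution r \<and> (\<forall>x. Fop x (r - flip2 r) = 0)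
     \<and> leibniz_bialgebra (cobracket r)"

definition factorizable :: "(('a \<Rightarrow> 'k) \<Rightarrow> ('a \<Rightarrow> 'k) \<Rightarrow> 'k) \<Rightarrow> bool" where
  "factorizable r \<longleftrightarrow> quasi_triangular r \<and> linear_iso_dual (op_form (r - flip2 r))"

definition rota_baxter :: "('a \<Rightarrow> 'a) \<Rightarrow> 'k \<Rightarrow> bool" where
  "rota_baxter \<beta> lam \<longleftrightarrow> Vector_Spaces.linear scale scale \<beta> \<and>
     (\<forall>x y. \<beta> x \<cdot> \<beta> y = \<beta> (x \<cdot> \<beta> y + \<beta> x \<cdot> y + scale lam (x \<cdot> y)))"

lemma bracket_dual:
  assumes "f \<in> dual"
  shows "(\<lambda>x. f (x \<cdot> y)) \<in> dual" "(\<lambda>y. f (x \<cdot> y)) \<in> dual"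
  using assms bracket_linear_left[of y] bracket_linear_right[of x]
  by (auto simp: dual_iff Vector_Spaces.linear_iff)

lemma clyb_sum_pure2:
  fixes n :: nat
  shows "clyb (\<Sum>i<n. pure2 (a i) (b i)) =
    (\<Sum>i<n. \<Sum>j<n. pure3 (a i \<cdot> a j) (b i) (b j)
                    - pure3 (a i) (b i \<cdot> a j + a j \<cdot> b i) (b j)
                    + pure3 (a i) (a j) (b j \<cdot> b i))"
proof -
  define E where "E = (\<lambda>(n::nat) a b. \<Sum>i<n. \<Sum>j<n. pure3 (a i \<cdot> a j) (b i) (b j)
                    - pure3 (a i) (b i \<cdot> a j + a j \<cdot> b i) (b j)
                    + pure3 (a i) (a j) (b j \<cdot> b i))"
  define C where "C = (\<lambda>r. restr3 (\<lambda>f g h.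
       r (\<lambda>x. r (\<lambda>y. f (x \<cdot> y)) h) g - r f (\<lambda>x. r (\<lambda>y. g (x \<cdot> y) + g (y \<cdot> x)) h)
       + r f (\<lambda>x. r g (\<lambda>y. h (y \<cdot> x)))))"
  have E: "E n a b = C (\<Sum>i<n. pure2 (a i) (b i))" for n a b
  proof (intro ext)
    fix f g h
    show "E n a b f g h = C (\<Sum>i<n. pure2 (a i) (b i)) f g h"
    proof (cases "f \<in> dual \<and> g \<in> dual \<and> h \<in> dual")
      case False
      thus ?thesis by (auto simp: E_def C_def sum_fun3 restr3_def pure3_def intro!: sum.neutral)
    next
      case True
      hence T: "f \<in> dual" "g \<in> dual" "h \<in> dual" by auto
      let ?r = "\<Sum>i<n. pure2 (a i) (b i)"
      have r: "?r p q = (\<Sum>i<n. p (a i) * q (b i))" if "p \<in> dual" "q \<in> dual" for p q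
        using that by (simp add: sum_fun2 pure2_def restr2_def)
      have lin: "(\<lambda>x. \<Sum>i<n. F i x * c i) \<in> dual" "(\<lambda>x. \<Sum>i<n. c i * F i x) \<in> dual"
        if "\<And>i. F i \<in> dual" for F c
        using that by (auto simp: dual_iff sum.distrib sum_distrib_left algebra_simps)
      have s: "(\<lambda>y. g (x \<cdot> y) + g (y \<cdot> x)) \<in> dual" "(\<lambda>x. g (x \<cdot> y) + g (y \<cdot> x)) \<in> dual" for x y
        using bracket_dual[OF T(2)] by (auto simp: dual_iff algebra_simps)
      have "C ?r f g h = (\<Sum>i<n. (\<Sum>j<n. f (a i \<cdot> a j) * h (b j)) * g (b i))
          - (\<Sum>i<n. f (a i) * (\<Sum>j<n. (g (b i \<cdot> a j) + g (a j \<cdot> b i)) * h (b j)))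
          + (\<Sum>i<n. f (a i) * (\<Sum>j<n. g (a j) * h (b j \<cdot> b i)))"
        using T by (simp add: C_def restr3_def r bracket_dual s lin)
      also have "\<dots> = E n a b f g h"
        using T by (simp add: E_def sum_fun3 pure3_def restr3_def dual_add sum.distrib sum_subtractf
            sum_distrib_left sum_distrib_right algebra_simps)
      finally show ?thesis ..
    qed
  qed
  have "(THE t. \<exists>(m::nat) c d. (\<Sum>i<n. pure2 (a i) (b i)) = (\<Sum>i<m. pure2 (c i) (d i)) \<and> t = E m c d)
      = E n a b"
    using E by (intro the_equality) (blast, metis)
  thus ?thesis unfolding clyb_def E_def .
qed

end

locale skew_quadratic_leibniz_algebra = leibniz_algebra scale bracket
  for scale :: "'k::{alg_closed_field, field_char_0} \<Rightarrow> 'a::ab_group_add \<Rightarrow> 'a"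
    and bracket :: "'a \<Rightarrow> 'a \<Rightarrow> 'a" (infixl "\<cdot>" 70) +
  fixes \<omega> :: "'a \<Rightarrow> 'a \<Rightarrow> 'k"
  assumes form_linear_left: "Vector_Spaces.linear scale (*) (\<lambda>x. \<omega> x y)"
    and form_linear_right: "Vector_Spaces.linear scale (*) (\<lambda>y. \<omega> x y)"
    and form_skew: "\<omega> x y = - \<omega> y x"
    and form_nondegenerate: "(\<And>y. \<omega> x y = 0) \<Longrightarrow> x = 0"
    and form_invariant: "\<omega> x (y \<cdot> z) = \<omega> (x \<cdot> z + z \<cdot> x) y"

locale skew_quadratic_rota_baxter_leibniz_algebra = skew_quadratic_leibniz_algebra scale bracket \<omega>
  for scale :: "'k::{alg_closed_field, field_char_0} \<Rightarrow> 'a::ab_group_add \<Rightarrow> 'a"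
    and bracket :: "'a \<Rightarrow> 'a \<Rightarrow> 'a" (infixl "\<cdot>" 70)
    and \<omega> :: "'a \<Rightarrow> 'a \<Rightarrow> 'k" +
  fixes \<beta> :: "'a \<Rightarrow> 'a" and lam :: 'k
  assumes rota_baxter: "rota_baxter \<beta> lam"
    and form_rota_baxter: "\<omega> (\<beta> x) y + \<omega> x (\<beta> y) + lam * \<omega> x y = 0"

text \<open>The map \<open>\<omega>\<^sup>\<sharp>\<close> into the dual is \<open>x \<mapsto> (y \<mapsto> \<omega> x y)\<close>.\<close>

definition sharp :: "('a \<Rightarrow> 'a \<Rightarrow> 'k) \<Rightarrow> 'a \<Rightarrow> ('a \<Rightarrow> 'k)" where
  "sharp \<omega> = (\<lambda>x. (\<lambda>y. \<omega> x y))"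

lemma (in skew_quadratic_leibniz_algebra) bij_betw_sharp: "bij_betw (sharp \<omega>) UNIV dual"
proof -
  obtain Basis where "finite_dimensional_vector_space scale Basis" using finite_dim by blast
  then interpret fd: finite_dimensional_vector_space scale Basis .
  have ll: "\<omega> (x + x') y = \<omega> x y + \<omega> x' y" "\<omega> (scale c x) y = c * \<omega> x y" for x x' y c
    using form_linear_left[of y] by (auto simp: Vector_Spaces.linear_iff)
  have dual: "\<omega> x \<in> dual" for x using form_linear_right[of x] by (simp add: dual_def)
  have determined: "f = g" if f: "f \<in> dual" and g: "g \<in> dual"
    and e: "\<And>e. e \<in> Basis \<Longrightarrow> f e = g e" for f g
  proof
    fix x
    have x: "x = (\<Sum>e\<in>Basis. scale (representation Basis x e) e)"
      using sum_representation_eq[OF fd.independent_Basis _ fd.finite_Basis subset_refl, of x]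
      by (simp add: fd.span_Basis)
    show "f x = g x" by (subst (1 2) x) (simp add: dual_sum dual_scale f g e)
  qed
  have inj: "inj (sharp \<omega>)"
  proof (rule injI)
    fix x y assume eq: "sharp \<omega> x = sharp \<omega> y"
    have "\<omega> (x - y) z = 0" for z
      using ll(1)[of "x - y" y z] fun_cong[OF eq, of z] by (simp add: sharp_def)
    thus "x = y" using form_nondegenerate[of "x - y"] by simp
  qed
  define \<phi> where "\<phi> x = (\<Sum>e\<in>Basis. scale (\<omega> x e) e)" for x
  have lin: "Vector_Spaces.linear scale scale \<phi>"
    by (auto simp: Vector_Spaces.linear_iff vector_space_axioms \<phi>_def ll scale_left_distrib sum.distrib
        scale_sum_right)
  have coeff: "p e = q e" if eq: "(\<Sum>e\<in>Basis. scale (p e) e) = (\<Sum>e\<in>Basis. scale (q e) e)"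
    and e: "e \<in> Basis" for p q e
  proof -
    have "(\<Sum>e\<in>Basis. scale (p e - q e) e) = 0"
      using eq by (simp add: scale_left_diff_distrib sum_subtractf)
    hence "p e - q e = 0"
      by (rule independentD[OF fd.independent_Basis fd.finite_Basis subset_refl _ e])
    thus ?thesis by simp
  qed
  have "inj \<phi>"
  proof (rule injI)
    fix x y assume "\<phi> x = \<phi> y"
    hence "\<omega> x e = \<omega> y e" if "e \<in> Basis" for e
      using coeff[of "\<omega> x" "\<omega> y"] that by (simp add: \<phi>_def)
    hence "\<omega> x = \<omega> y" by (intro determined dual)
    thus "x = y" using injD[OF inj] by (simp add: sharp_def)
  qed
  with lin have surj: "surj \<phi>" by (rule fd.linear_inj_imp_surj)
  have "f \<in> range (sharp \<omega>)" if f: "f \<in> dual" for f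
  proof -
    obtain x where "(\<Sum>e\<in>Basis. scale (f e) e) = \<phi> x" using surjD[OF surj] by blast
    hence "\<omega> x e = f e" if "e \<in> Basis" for e
      using coeff[of f "\<omega> x"] that by (simp add: \<phi>_def)
    hence "\<omega> x = f" by (intro determined dual f)
    hence "f = sharp \<omega> x" by (simp add: sharp_def)
    thus ?thesis by (rule range_eqI)
  qed
  moreover have "range (sharp \<omega>) \<subseteq> dual" using dual by (auto simp: sharp_def)
  ultimately have "range (sharp \<omega>) = dual" by (intro equalityI subsetI) auto
  thus ?thesis using inj by (simp add: bij_betw_def)
qed

end

theory Submission
  imports Defs
begin

text \<open>
  The form identifies \<open>A\<close> with its dual, so every identity between tensors may be tested on the
  functionals \<open>\<omega> u\<close>.  There \<open>r\<close> becomes \<open>(u, v) \<mapsto> \<omega> v (\<beta> u)\<close>, and \<open>r - \<sigma> r\<close> becomes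
  \<open>\<lambda> \<omega>\<close>, which is invariant and nondegenerate.  The Yang-Baxter tensor pairs to \<open>\<omega> z\<close> applied to
  the defect of the Rota-Baxter identity, and \<open>\<Delta>\<^sub>r\<close> is dual to the descendent bracket
  \<open>u \<odot> v = u \<cdot> \<beta> v + \<beta> u \<cdot> v + \<lambda> u \<cdot> v\<close>, which is again a Leibniz bracket.
\<close>

section \<open>Tensors and linear maps out of the dual space\<close>

context vect
begin

lemma tensor2_eqI:
  assumes "\<And>f g. f \<in> dual \<Longrightarrow> g \<in> dual \<Longrightarrow> s f g = t f g"
    and "\<And>f g. f \<notin> dual \<or> g \<notin> dual \<Longrightarrow> s f g = 0"
    and "\<And>f g. f \<notin> dual \<or> g \<notin> dual \<Longrightarrow> t f g = 0"
  shows "s = t"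
  using assms by (metis ext)

text \<open>Expansion in the dual basis: with coordinate functionals \<open>?e e\<close>, linearity
  gives \<open>T f\<close> as the sum of the vectors \<open>scale (f e) (T (?e e))\<close>, so the
  tensor is the finite sum of the \<open>pure2 e (T (?e e))\<close>.\<close>

lemma restr2_in_tensor2:
  assumes fd: "\<exists>Basis. finite_dimensional_vector_space scale Basis"
    and add: "\<And>f g. f \<in> dual \<Longrightarrow> g \<in> dual \<Longrightarrow> T (f + g) = T f + T g"
    and hom: "\<And>c f. f \<in> dual \<Longrightarrow> T (\<lambda>x. c * f x) = scale c (T f)"
  shows "restr2 (\<lambda>f g. g (T f)) \<in> tensor2"
proof -
  obtain Basis where "finite_dimensional_vector_space scale Basis" using fd by blast
  then interpret fd: finite_dimensional_vector_space scale Basis .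
  let ?e = "\<lambda>e x. representation Basis x e"
  have e: "?e e \<in> dual" for e
    by (auto simp: dual_iff representation_add[OF fd.independent_Basis]
        representation_scale[OF fd.independent_Basis] fd.span_Basis)
  have ce: "(\<lambda>x. c * ?e e x) \<in> dual" for c e
    using e[of e] by (auto simp: dual_iff algebra_simps)
  \<comment> \<open>The zero functional is 0 times some coordinate functional; \<open>?e\<close>
    lies in the dual for every index, so an arbitrary one serves.\<close>
  have T0: "T (\<lambda>x. 0) = 0"
    using hom[OF e, of 0 undefined] by simp
  have sums: "(\<lambda>x. \<Sum>e\<in>I. c e * ?e e x) \<in> dual \<and>
      T (\<lambda>x. \<Sum>e\<in>I. c e * ?e e x) = (\<Sum>e\<in>I. scale (c e) (T (?e e)))" for I c
  proof (induction I rule: infinite_finite_induct)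
    case (insert i I)
    have eq: "(\<lambda>x. \<Sum>e\<in>insert i I. c e * ?e e x)
        = (\<lambda>x. c i * ?e i x) + (\<lambda>x. \<Sum>e\<in>I. c e * ?e e x)"
      using insert.hyps by (simp add: fun_eq_iff)
    show ?case
    proof
      show "T (\<lambda>x. \<Sum>e\<in>insert i I. c e * ?e e x) = (\<Sum>e\<in>insert i I. scale (c e) (T (?e e)))"
        unfolding eq using insert by (simp add: add[OF ce] hom[OF e])
      show "(\<lambda>x. \<Sum>e\<in>insert i I. c e * ?e e x) \<in> dual"
        unfolding eq using insert.IH ce[of "c i" i] by (auto simp: dual_iff algebra_simps)
    qed
  qed (auto simp: T0 dual_iff)
  have expand: "f = (\<lambda>x. \<Sum>e\<in>Basis. f e * ?e e x)" if f: "f \<in> dual" for f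
  proof
    fix x
    have "x = (\<Sum>e\<in>Basis. scale (?e e x) e)"
      using sum_representation_eq[OF fd.independent_Basis _ fd.finite_Basis subset_refl, of x]
      by (simp add: fd.span_Basis)
    hence "f x = f (\<Sum>e\<in>Basis. scale (?e e x) e)" by (rule arg_cong)
    thus "f x = (\<Sum>e\<in>Basis. f e * ?e e x)"
      by (simp add: dual_sum dual_scale f mult.commute)
  qed
  have T: "T f = (\<Sum>e\<in>Basis. scale (f e) (T (?e e)))" if "f \<in> dual" for f
    using sums[of f Basis] expand[OF that] by simp
  \<comment> \<open>\<open>tensor2\<close> asks for a sum over an initial segment of the naturals,
    hence the enumeration of the basis.\<close>
  obtain h where h: "bij_betw h {..<card Basis} Basis"
    using ex_bij_betw_nat_finite[OF fd.finite_Basis] by (auto simp: atLeast0LessThan)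
  have "restr2 (\<lambda>f g. g (T f)) = (\<Sum>i<card Basis. pure2 (h i) (T (?e (h i))))"
  proof (intro ext)
    fix f g
    show "restr2 (\<lambda>f g. g (T f)) f g = (\<Sum>i<card Basis. pure2 (h i) (T (?e (h i)))) f g"
    proof (cases "f \<in> dual \<and> g \<in> dual")
      case True
      hence "g (T f) = (\<Sum>e\<in>Basis. f e * g (T (?e e)))"
        by (subst T) (auto simp: dual_sum dual_scale)
      also have "\<dots> = (\<Sum>i<card Basis. f (h i) * g (T (?e (h i))))"
        by (rule sum.reindex_bij_betw[OF h, symmetric])
      finally show ?thesis using True by (simp add: sum_fun2 pure2_def restr2_def)
    qed (auto simp: sum_fun2 pure2_def restr2_def)
  qed
  thus ?thesis unfolding tensor2_def by (intro CollectI exI)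
qed

end

text \<open>Contracting \<open>r\<close> with one functional per slot replaces the double sum over a
  decomposition by nested evaluations of \<open>r\<close>. In this form it suffices to know the
  values of \<open>r\<close>.\<close>

lemma (in leibniz_algebra) clyb_apply:
  assumes "r \<in> tensor2" and T: "f \<in> dual" "g \<in> dual" "h \<in> dual"
  shows "clyb r f g h = r (\<lambda>x. r (\<lambda>y. f (x \<cdot> y)) h) g
    - r f (\<lambda>x. r (\<lambda>y. g (x \<cdot> y + y \<cdot> x)) h) + r f (\<lambda>x. r g (\<lambda>y. h (y \<cdot> x)))"
proof -
  obtain n :: nat and a b where r: "r = (\<Sum>i<n. pure2 (a i) (b i))"
    using assms(1) by (auto simp: tensor2_def)
  have eval: "r p q = (\<Sum>i<n. p (a i) * q (b i))" if "p \<in> dual" "q \<in> dual" for p q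
    using that by (simp add: r sum_fun2 pure2_def restr2_def)
  have lin: "(\<lambda>x. \<Sum>i<n. F i x * c i) \<in> dual" "(\<lambda>x. \<Sum>i<n. c i * F i x) \<in> dual"
    if "\<And>i. F i \<in> dual" for F c
    using that by (auto simp: dual_iff sum.distrib sum_distrib_left algebra_simps)
  have s: "(\<lambda>y. g (x \<cdot> y) + g (y \<cdot> x)) \<in> dual" "(\<lambda>x. g (x \<cdot> y) + g (y \<cdot> x)) \<in> dual" for x y
    using bracket_dual[OF T(2)] by (auto simp: dual_iff algebra_simps)
  show ?thesis
    using T by (simp add: eval bracket_dual s lin dual_add)
      (simp add: r clyb_sum_pure2 sum_fun3 pure3_def restr3_def dual_add sum.distrib sum_subtractf
        sum_distrib_left sum_distrib_right algebra_simps)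
qed

lemma (in leibniz_algebra) clyb_outside_dual:
  assumes "r \<in> tensor2" "f \<notin> dual \<or> g \<notin> dual \<or> h \<notin> dual"
  shows "clyb r f g h = 0"
proof -
  obtain n :: nat and a b where r: "r = (\<Sum>i<n. pure2 (a i) (b i))"
    using assms(1) by (auto simp: tensor2_def)
  show ?thesis
    using assms(2) by (auto simp: r clyb_sum_pure2 sum_fun3 pure3_def restr3_def)
qed

section \<open>Consequences of the Leibniz rule\<close>

context leibniz_algebra
begin

lemma bracket_add_left: "(x + y) \<cdot> z = x \<cdot> z + y \<cdot> z"
  and bracket_scale_left: "scale c x \<cdot> z = scale c (x \<cdot> z)"
  using bracket_linear_left[of z] by (auto simp: Vector_Spaces.linear_iff)

lemma bracket_add_right: "z \<cdot> (x + y) = z \<cdot> x + z \<cdot> y"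
  and bracket_scale_right: "z \<cdot> scale c x = scale c (z \<cdot> x)"
  using bracket_linear_right[of z] by (auto simp: Vector_Spaces.linear_iff)

text \<open>The Leibniz rules for \<open>x, y\<close> and for \<open>y, x\<close> add up to this:
  the two iterated brackets on the left reappear on the right and cancel.\<close>

lemma symmetrizer_bracket: "(x \<cdot> y) \<cdot> z + (y \<cdot> x) \<cdot> z = 0"
  using leibniz[of x y z] leibniz[of y x z] by (simp add: algebra_simps)

lemmas bracket_simps = bracket_add_left bracket_scale_left bracket_add_right bracket_scale_right

end

section \<open>Adjoints for the invariant form, and tensors of endomorphisms\<close>

context skew_quadratic_leibniz_algebra
begin

lemma form_add_left: "\<omega> (x + y) z = \<omega> x z + \<omega> y z"
  and form_scale_left: "\<omega> (scale c x) z = c * \<omega> x z"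
  using form_linear_left[of z] by (auto simp: Vector_Spaces.linear_iff)

lemma form_add_right: "\<omega> z (x + y) = \<omega> z x + \<omega> z y"
  and form_scale_right: "\<omega> z (scale c x) = c * \<omega> z x"
  using form_linear_right[of z] by (auto simp: Vector_Spaces.linear_iff)

lemma form_0_left: "\<omega> 0 z = 0"
  using form_scale_left[of 0 0 z] by simp

lemma form_minus_left: "\<omega> (- x) z = - \<omega> x z"
  using form_scale_left[of "-1" x z] by simp

lemma form_minus_right: "\<omega> z (- x) = - \<omega> z x"
  using form_scale_right[of z "-1" x] by simp

lemma form_diff_left: "\<omega> (x - y) z = \<omega> x z - \<omega> y z"
  using form_add_left[of x "- y" z] by (simp add: form_minus_left)

lemma form_diff_right: "\<omega> z (x - y) = \<omega> z x - \<omega> z y"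
  using form_add_right[of z x "- y"] by (simp add: form_minus_right)

lemmas form_simps = form_add_left form_scale_left form_add_right form_scale_right
  form_minus_left form_minus_right form_diff_left form_diff_right

text \<open>Invariance read through skew-symmetry: \<open>Rm a\<close> and
  \<open>Lm a + Rm a\<close> are adjoint to each other.\<close>

lemma form_bracket: "\<omega> (u \<cdot> a) v = \<omega> u (v \<cdot> a + a \<cdot> v)"
  using form_invariant[of v u a] form_invariant[of a u v] form_invariant[of u v a]
    form_skew[of "u \<cdot> a" v] form_skew[of "u \<cdot> v" a] form_skew[of u "v \<cdot> a + a \<cdot> v"]
  by (simp add: form_simps add.commute)

text \<open>The right-hand side of \<open>form_bracket\<close> is symmetric in \<open>a\<close> and
  \<open>v\<close>.\<close>

lemma form_bracket_swap: "\<omega> (u \<cdot> a) v = \<omega> (u \<cdot> v) a"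
  by (simp add: form_bracket add.commute)

lemma form_dual: "\<omega> u \<in> dual"
  using form_linear_right[of u] by (simp add: dual_def)

lemma dualE:
  assumes "f \<in> dual"
  obtains u where "f = \<omega> u"
  using assms bij_betw_sharp by (auto simp: bij_betw_def sharp_def)

lemma inv_sharp: "inv (sharp \<omega>) (\<omega> u) = u"
  using inv_f_f[of "sharp \<omega>" u] bij_betw_sharp by (simp add: bij_betw_def sharp_def)

text \<open>Transposes of the multiplications, carried from the dual to the algebra by the form. The
  third is the first minus the second; its sign is kept inside the argument so that the result is
  again of the shape \<open>\<omega> w\<close>.\<close>

lemma form_comp:
  "\<omega> u \<circ> (Lm a + Rm a) = \<omega> (u \<cdot> a)"
  "\<omega> u \<circ> Rm a = \<omega> (u \<cdot> a + a \<cdot> u)"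
  "\<omega> u \<circ> Lm a = \<omega> (- (a \<cdot> u))"
proof -
  show 1: "\<omega> u \<circ> (Lm a + Rm a) = \<omega> (u \<cdot> a)"
    by (simp add: fun_eq_iff Lm_def Rm_def form_bracket form_simps)
  show 2: "\<omega> u \<circ> Rm a = \<omega> (u \<cdot> a + a \<cdot> u)"
    by (simp add: fun_eq_iff Rm_def form_invariant)
  show "\<omega> u \<circ> Lm a = \<omega> (- (a \<cdot> u))"
  proof
    fix x
    show "(\<omega> u \<circ> Lm a) x = \<omega> (- (a \<cdot> u)) x"
      using fun_cong[OF 1, of x] fun_cong[OF 2, of x]
      by (simp add: Lm_def Rm_def form_simps eq_neg_iff_add_eq_0)
  qed
qed

text \<open>The tensor whose operator form is \<open>\<phi>\<close> after the inverse of
  \<open>sharp \<omega>\<close>; see \<open>op_form_tensor_of_endo\<close>.\<close>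

definition tensor_of_endo :: "('a \<Rightarrow> 'a) \<Rightarrow> ('a \<Rightarrow> 'k) \<Rightarrow> ('a \<Rightarrow> 'k) \<Rightarrow> 'k" where
  "tensor_of_endo \<phi> = restr2 (\<lambda>f g. g (\<phi> (inv (sharp \<omega>) f)))"

lemma tensor_of_endo_apply: "tensor_of_endo \<phi> (\<omega> u) (\<omega> v) = \<omega> v (\<phi> u)"
  by (simp add: tensor_of_endo_def restr2_def form_dual inv_sharp)

lemma tensor_of_endo_outside: "f \<notin> dual \<or> g \<notin> dual \<Longrightarrow> tensor_of_endo \<phi> f g = 0"
  by (auto simp: tensor_of_endo_def restr2_def)

lemma inv_sharp_add: "f \<in> dual \<Longrightarrow> g \<in> dual \<Longrightarrow>
    inv (sharp \<omega>) (f + g) = inv (sharp \<omega>) f + inv (sharp \<omega>) g"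
proof (elim dualE)
  fix u v assume "f = \<omega> u" "g = \<omega> v"
  moreover have "\<omega> u + \<omega> v = \<omega> (u + v)" by (simp add: fun_eq_iff form_simps)
  ultimately show ?thesis by (simp add: inv_sharp)
qed

lemma inv_sharp_scale: "f \<in> dual \<Longrightarrow>
    inv (sharp \<omega>) (\<lambda>x. c * f x) = scale c (inv (sharp \<omega>) f)"
proof (elim dualE)
  fix u assume "f = \<omega> u"
  moreover have "(\<lambda>x. c * \<omega> u x) = \<omega> (scale c u)" by (simp add: fun_eq_iff form_simps)
  ultimately show ?thesis by (simp add: inv_sharp)
qed

lemma tensor_of_endo_in_tensor2:
  assumes "Vector_Spaces.linear scale scale \<phi>"
  shows "tensor_of_endo \<phi> \<in> tensor2"
  unfolding tensor_of_endo_def using assms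
  by (intro restr2_in_tensor2 finite_dim)
    (auto simp: inv_sharp_add inv_sharp_scale Vector_Spaces.linear_iff)

lemma op_form_tensor_of_endo:
  assumes "Vector_Spaces.linear scale scale \<phi>" "f \<in> dual"
  shows "op_form (tensor_of_endo \<phi>) f = \<phi> (inv (sharp \<omega>) f)"
  using op_form_eq[OF tensor_of_endo_in_tensor2[OF assms(1)] assms(2)] assms(2)
  by (intro dual_separates) (simp add: tensor_of_endo_def restr2_def)

text \<open>The operator form is the inverse of \<open>sharp \<omega>\<close> followed by an
  invertible scalar. The case needed is the skew part of the r-matrix.\<close>

lemma linear_iso_dual_scale:
  assumes "c \<noteq> 0"
  shows "linear_iso_dual (op_form (tensor_of_endo (scale c)))"
proof -
  have lin: "Vector_Spaces.linear scale scale (scale c)"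
    by (auto simp: Vector_Spaces.linear_iff vector_space_axioms scale_right_distrib mult.commute)
  note op = op_form_tensor_of_endo[OF lin]
  have "bij (scale c)"
    using assms by (intro o_bij[where g = "scale (inverse c)"]) (auto simp: fun_eq_iff)
  moreover have "bij_betw (inv (sharp \<omega>)) dual UNIV"
    using bij_betw_inv_into[OF bij_betw_sharp] by simp
  ultimately have "bij_betw (scale c \<circ> inv (sharp \<omega>)) dual UNIV"
    by (rule bij_betw_trans[rotated])
  hence "bij_betw (op_form (tensor_of_endo (scale c))) dual UNIV"
    by (rule bij_betw_cong[THEN iffD1, rotated]) (simp add: op)
  moreover have "f + g \<in> dual" "(\<lambda>x. c * f x) \<in> dual" if "f \<in> dual" "g \<in> dual" for f g c
    using that by (auto simp: dual_iff algebra_simps)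
  ultimately show ?thesis
    by (auto simp: linear_iso_dual_def op inv_sharp_add inv_sharp_scale scale_right_distrib
        mult.commute)
qed

lemma map2_apply_form:
  "map2 (Lm a + Rm a) id s (\<omega> u) (\<omega> v) = s (\<omega> (u \<cdot> a)) (\<omega> v)"
  "map2 (Rm a) id s (\<omega> u) (\<omega> v) = s (\<omega> (u \<cdot> a + a \<cdot> u)) (\<omega> v)"
  "map2 (Lm a) id s (\<omega> u) (\<omega> v) = s (\<omega> (- (a \<cdot> u))) (\<omega> v)"
  "map2 id (Rm a) s (\<omega> u) (\<omega> v) = s (\<omega> u) (\<omega> (v \<cdot> a + a \<cdot> v))"
  "map2 id (Lm a) s (\<omega> u) (\<omega> v) = s (\<omega> u) (\<omega> (- (a \<cdot> v)))"
  by (simp_all add: map2_def restr2_def form_dual form_comp)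

lemma map2_outside: "f \<notin> dual \<or> g \<notin> dual \<Longrightarrow> map2 \<phi> \<psi> s f g = 0"
  by (auto simp: map2_def restr2_def)

lemma tensor2_eq_formI:
  assumes "\<And>u v. s (\<omega> u) (\<omega> v) = t (\<omega> u) (\<omega> v)"
    and "\<And>f g. f \<notin> dual \<or> g \<notin> dual \<Longrightarrow> s f g = 0"
    and "\<And>f g. f \<notin> dual \<or> g \<notin> dual \<Longrightarrow> t f g = 0"
  shows "s = t"
  by (rule tensor2_eqI) (use assms in \<open>auto elim!: dualE\<close>)

end

section \<open>The Rota-Baxter operator and the descendent bracket\<close>

context skew_quadratic_rota_baxter_leibniz_algebra
begin

lemma beta_linear: "Vector_Spaces.linear scale scale \<beta>"
  and beta_bracket: "\<beta> x \<cdot> \<beta> y = \<beta> (x \<cdot> \<beta> y + \<beta> x \<cdot> y + scale lam (x \<cdot> y))"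
  using rota_baxter by (auto simp: rota_baxter_def)

lemma beta_add: "\<beta> (x + y) = \<beta> x + \<beta> y"
  and beta_scale: "\<beta> (scale c x) = scale c (\<beta> x)"
  using beta_linear by (auto simp: Vector_Spaces.linear_iff)

lemma beta_adjoint: "\<omega> x (\<beta> y) = - \<omega> (\<beta> x) y - lam * \<omega> x y"
  using form_rota_baxter[of x y] by (simp add: algebra_simps eq_neg_iff_add_eq_0)

definition descendent :: "'a \<Rightarrow> 'a \<Rightarrow> 'a" (infixl "\<odot>" 70) where
  "u \<odot> v = u \<cdot> \<beta> v + \<beta> u \<cdot> v + scale lam (u \<cdot> v)"

lemma beta_descendent: "\<beta> (u \<odot> v) = \<beta> u \<cdot> \<beta> v"
  by (simp add: descendent_def beta_bracket)

text \<open>Since \<open>\<beta>\<close> sends \<open>\<odot>\<close> to \<open>\<cdot>\<close>, no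
  \<open>\<beta>\<close> of a product survives the expansion. What remains are iterated brackets of
  \<open>u\<close>, \<open>v\<close>, \<open>w\<close> and their images under
  \<open>\<beta>\<close>, matched by instances of the original Leibniz rule.\<close>

lemma descendent_leibniz: "u \<odot> (v \<odot> w) = (u \<odot> v) \<odot> w + v \<odot> (u \<odot> w)"
proof -
  have "u \<odot> (v \<odot> w) = u \<cdot> (\<beta> v \<cdot> \<beta> w) + \<beta> u \<cdot> (v \<odot> w) + scale lam (u \<cdot> (v \<odot> w))" for u v w
    by (simp add: descendent_def[of _ "_ \<odot> _"] beta_descendent)
  moreover have "(u \<odot> v) \<odot> w = (u \<odot> v) \<cdot> \<beta> w + (\<beta> u \<cdot> \<beta> v) \<cdot> w + scale lam ((u \<odot> v) \<cdot> w)"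
    by (simp add: descendent_def[of "_ \<odot> _"] beta_descendent)
  ultimately show ?thesis
    by (simp add: descendent_def bracket_simps scale_right_distrib leibniz[of u "\<beta> v"]
        leibniz[of "\<beta> u" v] leibniz[of "\<beta> u" "\<beta> v"] leibniz[of u v] algebra_simps)
qed

text \<open>A symmetrized product annihilates from the left, so of the three terms of
  \<open>\<odot>\<close> only the one with \<open>\<beta>\<close> on the left factor
  survives.\<close>

lemma symmetrizer_descendent: "(x \<cdot> y + y \<cdot> x) \<odot> z = \<beta> (x \<cdot> y + y \<cdot> x) \<cdot> z"
proof -
  have "(x \<cdot> y + y \<cdot> x) \<cdot> w = 0" for w
    using symmetrizer_bracket[of x y w] by (simp add: bracket_simps)
  thus ?thesis by (simp add: descendent_def)
qed

section \<open>The r-matrix, its cobracket and the Yang-Baxter equation\<close>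

definition rmat :: "('a \<Rightarrow> 'k) \<Rightarrow> ('a \<Rightarrow> 'k) \<Rightarrow> 'k" where
  "rmat = tensor_of_endo \<beta>"

lemma rmat_in_tensor2: "rmat \<in> tensor2"
  unfolding rmat_def by (rule tensor_of_endo_in_tensor2[OF beta_linear])

lemma rmat_apply: "rmat (\<omega> u) (\<omega> v) = \<omega> v (\<beta> u)"
  by (simp add: rmat_def tensor_of_endo_apply)

text \<open>Compatibility of \<open>\<beta>\<close> with the form makes the difference equal to
  \<open>lam * \<omega> u v\<close>. The minus sign appears because \<open>tensor_of_endo\<close>
  pairs \<open>\<omega> v\<close> with the image of \<open>u\<close>, in the opposite order.\<close>

lemma rmat_skew_part: "rmat - flip2 rmat = tensor_of_endo (scale (- lam))"
proof (rule tensor2_eq_formI)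
  fix u v
  show "(rmat - flip2 rmat) (\<omega> u) (\<omega> v) = tensor_of_endo (scale (- lam)) (\<omega> u) (\<omega> v)"
    using beta_adjoint[of u v] form_skew[of v "\<beta> u"] form_skew[of u v]
    by (simp add: flip2_def rmat_apply tensor_of_endo_apply form_simps)
qed (auto simp: flip2_def rmat_def tensor_of_endo_outside)

lemma Fop_outside: "f \<notin> dual \<or> g \<notin> dual \<Longrightarrow> Fop a s f g = 0"
  by (simp add: Fop_def map2_outside)

text \<open>On a multiple of the form, \<open>Fop a\<close> gives that multiple of the difference of
  the two sides of \<open>form_bracket\<close>.\<close>

lemma Fop_skew_part: "Fop a (rmat - flip2 rmat) = 0"
proof (rule tensor2_eq_formI)
  fix u v
  show "Fop a (rmat - flip2 rmat) (\<omega> u) (\<omega> v) = 0 (\<omega> u) (\<omega> v)"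
    using form_bracket[of u a v] form_skew[of v "u \<cdot> a"] form_skew[of "v \<cdot> a + a \<cdot> v" u]
    by (simp add: Fop_def map2_apply_form rmat_skew_part tensor_of_endo_apply form_simps
        flip: distrib_left)
qed (auto simp: Fop_outside)

text \<open>The first summand of \<open>Fop\<close> yields \<open>u \<cdot> \<beta> v\<close>
  together with the weight term, through the adjoint of \<open>\<beta>\<close>; the second yields
  \<open>\<beta> u \<cdot> v\<close>. The bialgebra axioms thereby become identities for
  \<open>\<odot>\<close> under the form.\<close>

lemma cobracket_apply: "cobracket rmat a (\<omega> u) (\<omega> v) = \<omega> (u \<odot> v) a"
proof -
  have "\<omega> (v \<cdot> a + a \<cdot> v) (\<beta> u) = - \<omega> (\<beta> u \<cdot> v) a"
    using form_bracket[of "\<beta> u" v a] form_skew[of "v \<cdot> a + a \<cdot> v" "\<beta> u"]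
    by (simp add: add.commute)
  moreover have "\<omega> w (u \<cdot> a) = - \<omega> (u \<cdot> w) a" for w
    using form_skew[of w "u \<cdot> a"] form_bracket_swap[of u a w] by simp
  ultimately show ?thesis
    by (simp add: cobracket_def Fop_def map2_apply_form rmat_apply beta_adjoint[of v]
        descendent_def form_simps)
qed

text \<open>Once \<open>z\<close> stands alone in the first argument of the form, the three terms
  carry \<open>- \<beta> (\<beta> y \<cdot> x + scale lam (y \<cdot> x))\<close>,
  \<open>- \<beta> (y \<cdot> \<beta> x)\<close> and \<open>\<beta> y \<cdot> \<beta> x\<close>.
  Their sum vanishes by the Rota-Baxter identity for \<open>y, x\<close>.\<close>

lemma clybe_rmat: "clybe_solution rmat"
proof -
  have "clyb rmat f g h = 0" for f g h
  proof (cases "f \<in> dual \<and> g \<in> dual \<and> h \<in> dual")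
    case True
    then obtain x y z where fgh: "f = \<omega> x" "g = \<omega> y" "h = \<omega> z" by (metis dualE)
    have L: "(\<lambda>c. \<omega> u (a \<cdot> c)) = \<omega> (- (a \<cdot> u))"
      and R: "(\<lambda>c. \<omega> u (c \<cdot> a)) = \<omega> (u \<cdot> a + a \<cdot> u)"
      and S: "(\<lambda>c. \<omega> u (a \<cdot> c + c \<cdot> a)) = \<omega> (u \<cdot> a)" for u a
      using form_comp[of u a] by (simp_all add: o_def Lm_def Rm_def)
    \<comment> \<open>\<open>?b\<close> is minus the adjoint of \<open>\<beta>\<close>; the
      abbreviation keeps the weight terms folded until the last step.\<close>
    let ?b = "\<lambda>x. \<beta> x + scale lam x"
    have adj: "\<omega> p (\<beta> q) = - \<omega> (?b p) q" for p q
      by (simp add: beta_adjoint form_simps)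
    have adj': "\<omega> (\<beta> p) q = - \<omega> p (?b q)" for p q
      by (simp add: beta_adjoint form_simps)
    have skew: "\<omega> p (q \<cdot> c) = - \<omega> (q \<cdot> p) c" for p q c
      using form_skew[of p "q \<cdot> c"] form_bracket_swap[of q c p] by simp
    \<comment> \<open>Each inner contraction in \<open>clyb_apply\<close> is again of the shape
      \<open>\<omega> w\<close>, so \<open>rmat_apply\<close> evaluates the outer one too.\<close>
    have t1: "(\<lambda>a. rmat (\<lambda>c. f (a \<cdot> c)) h) = \<omega> (x \<cdot> ?b z + ?b z \<cdot> x)"
    proof
      fix a
      have "rmat (\<lambda>c. f (a \<cdot> c)) h = \<omega> (?b z) (a \<cdot> x)"
        unfolding fgh L rmat_apply adj by (simp add: form_simps)
      also have "\<dots> = \<omega> (x \<cdot> ?b z + ?b z \<cdot> x) a"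
        by (simp only: form_invariant add.commute)
      finally show "rmat (\<lambda>c. f (a \<cdot> c)) h = \<omega> (x \<cdot> ?b z + ?b z \<cdot> x) a" .
    qed
    have t2: "(\<lambda>a. rmat (\<lambda>c. g (a \<cdot> c + c \<cdot> a)) h) = \<omega> (y \<cdot> ?b z)"
      unfolding fgh S rmat_apply adj skew by simp
    have t3: "(\<lambda>a. rmat g (\<lambda>c. h (c \<cdot> a))) = \<omega> (- (\<beta> y \<cdot> z))"
    proof
      fix a
      have "rmat g (\<lambda>c. h (c \<cdot> a)) = \<omega> (z \<cdot> a + a \<cdot> z) (\<beta> y)"
        unfolding fgh R rmat_apply ..
      also have "\<dots> = \<omega> z (\<beta> y \<cdot> a)" by (simp only: form_invariant)
      also have "\<dots> = \<omega> (- (\<beta> y \<cdot> z)) a" by (simp add: skew form_simps)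
      finally show "rmat g (\<lambda>c. h (c \<cdot> a)) = \<omega> (- (\<beta> y \<cdot> z)) a" .
    qed
    have "clyb rmat f g h = \<omega> y (\<beta> (x \<cdot> ?b z + ?b z \<cdot> x))
        - \<omega> (y \<cdot> ?b z) (\<beta> x) + \<omega> (- (\<beta> y \<cdot> z)) (\<beta> x)"
      using clyb_apply[OF rmat_in_tensor2, of f g h] True
      by (simp only: t1 t2 t3) (simp add: fgh rmat_apply)
    \<comment> \<open>The adjoint of \<open>\<beta>\<close> is used twice: first to free the
      symmetrized product for \<open>form_bracket\<close>, then to strip \<open>?b\<close> from
      \<open>z\<close>.\<close>
    also have "\<omega> y (\<beta> (x \<cdot> ?b z + ?b z \<cdot> x)) = - \<omega> z (\<beta> (?b y \<cdot> x))"
    proof -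
      have "\<omega> y (\<beta> (x \<cdot> ?b z + ?b z \<cdot> x)) = - \<omega> (?b y \<cdot> x) (?b z)"
        by (simp only: adj form_bracket[of _ x] add.commute)
      also have "\<dots> = \<omega> (?b z) (?b y \<cdot> x)" by (simp only: form_skew[of "?b z"])
      finally show ?thesis by (simp only: adj) simp
    qed
    also have "\<omega> (y \<cdot> ?b z) (\<beta> x) = \<omega> z (\<beta> (y \<cdot> \<beta> x))"
      using form_bracket_swap[of y "?b z" "\<beta> x"] form_skew[of "y \<cdot> \<beta> x" "?b z"]
      by (simp only: adj)
    also have "\<omega> (- (\<beta> y \<cdot> z)) (\<beta> x) = \<omega> z (\<beta> y \<cdot> \<beta> x)"
      by (simp add: skew form_simps)
    also have "- \<omega> z (\<beta> (?b y \<cdot> x)) - \<omega> z (\<beta> (y \<cdot> \<beta> x)) + \<omega> z (\<beta> y \<cdot> \<beta> x) = 0"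
      unfolding beta_bracket by (simp add: beta_add beta_scale bracket_simps form_simps)
    finally show ?thesis .
  qed (simp add: clyb_outside_dual[OF rmat_in_tensor2])
  thus ?thesis by (simp add: clybe_solution_def rmat_in_tensor2 fun_eq_iff)
qed

section \<open>The bialgebra axioms for the cobracket\<close>

lemma cobracket_outside: "f \<notin> dual \<or> g \<notin> dual \<Longrightarrow> cobracket rmat a f g = 0"
  by (simp add: cobracket_def Fop_outside)

lemma cobracket_linear: "Vector_Spaces.linear scale tscale (cobracket rmat)"
proof -
  have "vector_space tscale"
    by unfold_locales (auto simp: tscale_def fun_eq_iff algebra_simps)
  moreover have "cobracket rmat (x + y) = cobracket rmat x + cobracket rmat y" for x y
    by (rule tensor2_eq_formI) (auto simp: cobracket_apply form_simps cobracket_outside)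
  moreover have "cobracket rmat (scale c x) = tscale c (cobracket rmat x)" for c x
    by (rule tensor2_eq_formI) (auto simp: cobracket_apply form_simps cobracket_outside tscale_def)
  ultimately show ?thesis
    by (simp add: Vector_Spaces.linear_iff vector_space_axioms)
qed

lemma cobracket_in_tensor2: "cobracket rmat a \<in> tensor2"
proof -
  \<comment> \<open>This is the operator form of the cobracket at \<open>a\<close>: invariance turns
    \<open>\<omega> (v \<cdot> a + a \<cdot> v) (\<beta> u)\<close> into
    \<open>\<omega> v (\<beta> u \<cdot> a)\<close>.\<close>
  let ?\<phi> = "\<lambda>u. \<beta> (u \<cdot> a) - \<beta> u \<cdot> a"
  have "Vector_Spaces.linear scale scale ?\<phi>"
    by (auto simp: Vector_Spaces.linear_iff vector_space_axioms beta_add beta_scale bracket_simps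
        scale_right_diff_distrib)
  hence "tensor_of_endo ?\<phi> \<in> tensor2" by (rule tensor_of_endo_in_tensor2)
  moreover have "cobracket rmat a = tensor_of_endo ?\<phi>"
    by (rule tensor2_eq_formI)
      (auto simp: cobracket_def Fop_def map2_apply_form rmat_apply tensor_of_endo_apply form_simps
        form_invariant map2_outside tensor_of_endo_outside)
  ultimately show ?thesis by simp
qed

text \<open>On \<open>\<omega> u\<close>, \<open>\<omega> v\<close>, \<open>\<omega> w\<close> the
  three terms pair \<open>a\<close> with \<open>(u \<odot> v) \<odot> w\<close>,
  \<open>v \<odot> (u \<odot> w)\<close> and \<open>u \<odot> (v \<odot> w)\<close>, so this is the
  Leibniz rule of \<open>\<odot>\<close>.\<close>

lemma cobracket_coleibniz:
  "comul_left (cobracket rmat) (cobracket rmat a)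
    + flip12 (comul_right (cobracket rmat) (cobracket rmat a))
    - comul_right (cobracket rmat) (cobracket rmat a) = 0"
proof (intro ext)
  fix f g h
  let ?D = "cobracket rmat"
  show "(comul_left ?D (?D a) + flip12 (comul_right ?D (?D a)) - comul_right ?D (?D a)) f g h
      = 0 f g h"
  proof (cases "f \<in> dual \<and> g \<in> dual \<and> h \<in> dual")
    case True
    then obtain u v w where "f = \<omega> u" "g = \<omega> v" "h = \<omega> w" by (metis dualE)
    thus ?thesis
      using descendent_leibniz[of u v w]
      by (simp add: comul_left_def comul_right_def flip12_def restr3_def form_dual
          cobracket_apply form_simps)
  qed (auto simp: comul_left_def comul_right_def flip12_def restr3_def)
qed

text \<open>With the symmetrized products \<open>?P\<close> and \<open>?Q\<close>, the sides become
  \<open>\<omega> (\<beta> ?P) ?Q\<close> and \<open>\<omega> (\<beta> ?Q) ?P\<close>. By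
  adjointness they differ by a multiple of \<open>\<omega> ?P ?Q\<close>, which is zero because
  \<open>?P\<close> annihilates \<open>u\<close> from the left.\<close>

lemma cobracket_symmetry:
  "flip2 (map2 (Rm y) id (cobracket rmat x)) = map2 (Rm x) id (cobracket rmat y)"
proof (rule tensor2_eq_formI)
  fix u v
  let ?P = "v \<cdot> y + y \<cdot> v" and ?Q = "u \<cdot> x + x \<cdot> u"
  have "?P \<cdot> u = 0" using symmetrizer_bracket[of v y u] by (simp add: bracket_simps)
  hence PQ: "\<omega> ?P ?Q = 0"
    using form_bracket[of ?P u x] by (simp add: add.commute form_0_left)
  have "\<omega> (\<beta> ?P \<cdot> u) x = \<omega> (\<beta> ?P) ?Q"
    using form_bracket[of "\<beta> ?P" u x] by (simp only: add.commute)
  also have "\<dots> = \<omega> (\<beta> ?Q) ?P"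
    using beta_adjoint[of ?P ?Q] PQ form_skew[of "\<beta> ?Q" ?P] by simp
  also have "\<dots> = \<omega> (\<beta> ?Q \<cdot> v) y"
    using form_bracket[of "\<beta> ?Q" v y] by (simp only: add.commute)
  finally show "flip2 (map2 (Rm y) id (cobracket rmat x)) (\<omega> u) (\<omega> v)
      = map2 (Rm x) id (cobracket rmat y) (\<omega> u) (\<omega> v)"
    by (simp only: flip2_def map2_apply_form cobracket_apply symmetrizer_descendent)
qed (auto simp: flip2_def map2_outside)

text \<open>The compatibility condition, dualized.  Moving everything except \<open>y\<close> into the first argument
  of the form leaves an identity of the algebra that follows from the Leibniz rule alone.\<close>

lemma descendent_compatible:
  "\<omega> (u \<odot> v) (x \<cdot> y) =
     \<omega> (u \<odot> (v \<cdot> y + y \<cdot> v) + (v \<cdot> y + y \<cdot> v) \<odot> u) x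
     - \<omega> ((u \<cdot> y) \<odot> v + v \<odot> (u \<cdot> y)) x - \<omega> (u \<odot> (x \<cdot> v)) y - \<omega> ((x \<cdot> u) \<odot> v) y"
proof -
  let ?b = "\<lambda>x. \<beta> x + scale lam x"
  have desc: "p \<odot> q = p \<cdot> ?b q + \<beta> p \<cdot> q" for p q
    by (simp add: descendent_def bracket_simps)
  have adj: "\<omega> p (?b q) = - \<omega> (\<beta> p) q" "\<omega> (\<beta> p) q = - \<omega> p (?b q)" for p q
    by (simp_all add: beta_adjoint form_simps)
  have skew: "\<omega> p (q \<cdot> c) = - \<omega> (q \<cdot> p) c" for p q c
    using form_skew[of p "q \<cdot> c"] form_bracket_swap[of q c p] by simp
  have sym: "\<omega> p (q \<cdot> c + c \<cdot> q) = \<omega> (p \<cdot> q) c" for p q c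
    using form_bracket[of p q c] by (simp add: add.commute)
  let ?S = "v \<cdot> y + y \<cdot> v"
  \<comment> \<open>Each term on the right involving \<open>x\<close> is now rewritten so that
    \<open>y\<close> alone fills the second argument.\<close>
  have "\<omega> (u \<odot> ?S) x = - \<omega> (\<beta> (u \<cdot> x) \<cdot> v) y + \<omega> ((\<beta> u \<cdot> x) \<cdot> v) y"
  proof -
    have "\<omega> (u \<cdot> ?b ?S) x = - \<omega> (\<beta> (u \<cdot> x) \<cdot> v) y"
      by (simp only: form_bracket_swap[of u "?b ?S"] adj(1) sym)
    moreover have "\<omega> (\<beta> u \<cdot> ?S) x = \<omega> ((\<beta> u \<cdot> x) \<cdot> v) y"
      by (simp only: form_bracket_swap[of "\<beta> u" ?S] sym)
    ultimately show ?thesis by (simp only: desc form_add_left)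
  qed
  moreover have "\<omega> (?S \<odot> u) x = \<omega> (\<beta> (u \<cdot> x + x \<cdot> u) \<cdot> v) y"
  proof -
    have "\<omega> (?S \<odot> u) x = \<omega> (\<beta> ?S) (u \<cdot> x + x \<cdot> u)"
      by (simp only: symmetrizer_descendent sym)
    also have "\<dots> = - \<omega> ?S (?b (u \<cdot> x + x \<cdot> u))" by (simp only: adj(2))
    also have "\<dots> = \<omega> (?b (u \<cdot> x + x \<cdot> u)) ?S" by (simp only: form_skew[of "?b _" ?S])
    also have "\<dots> = \<omega> (?b (u \<cdot> x + x \<cdot> u) \<cdot> v) y" by (simp only: sym)
    \<comment> \<open>The weight part of \<open>?b\<close> drops out, since the symmetrized product
      annihilates \<open>v\<close>.\<close>
    also have "?b (u \<cdot> x + x \<cdot> u) \<cdot> v = \<beta> (u \<cdot> x + x \<cdot> u) \<cdot> v"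
      using symmetrizer_bracket[of u x v]
      by (simp add: bracket_simps flip: scale_right_distrib)
    finally show ?thesis .
  qed
  moreover have "\<omega> ((u \<cdot> y) \<odot> v) x =
      \<omega> (u \<cdot> (?b v \<cdot> x + x \<cdot> ?b v)) y - \<omega> (u \<cdot> ?b (v \<cdot> x + x \<cdot> v)) y"
  proof -
    have "\<omega> ((u \<cdot> y) \<cdot> ?b v) x = \<omega> (u \<cdot> (?b v \<cdot> x + x \<cdot> ?b v)) y"
      by (simp only: sym[symmetric, of _ "?b v" x] form_bracket_swap[of u y])
    moreover have "\<omega> (\<beta> (u \<cdot> y) \<cdot> v) x = - \<omega> (u \<cdot> ?b (v \<cdot> x + x \<cdot> v)) y"
      by (simp only: sym[symmetric, of _ v x] adj(2) form_bracket_swap[of u y])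
    ultimately show ?thesis by (simp only: desc form_add_left) simp
  qed
  moreover have "\<omega> (v \<odot> (u \<cdot> y)) x = \<omega> (u \<cdot> \<beta> (v \<cdot> x)) y - \<omega> (u \<cdot> (\<beta> v \<cdot> x)) y"
  proof -
    have "\<omega> (v \<cdot> ?b (u \<cdot> y)) x = \<omega> (u \<cdot> \<beta> (v \<cdot> x)) y"
      by (simp only: form_bracket_swap[of v "?b (u \<cdot> y)"] adj(1) skew) simp
    moreover have "\<omega> (\<beta> v \<cdot> (u \<cdot> y)) x = - \<omega> (u \<cdot> (\<beta> v \<cdot> x)) y"
      by (simp only: form_bracket_swap[of "\<beta> v" "u \<cdot> y"] skew)
    ultimately show ?thesis by (simp only: desc form_add_left) simp
  qed
  moreover have "\<omega> (u \<odot> v) (x \<cdot> y) = - \<omega> (x \<cdot> (u \<odot> v)) y" by (rule skew)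
  \<comment> \<open>The same identity with \<open>\<omega>\<close> and \<open>y\<close> stripped
    off. Flipping \<open>(\<beta> u \<cdot> x) \<cdot> v\<close> into
    \<open>- ((x \<cdot> \<beta> u) \<cdot> v)\<close> leaves only the Leibniz rule for left
    multiplication by \<open>x\<close>.\<close>
  moreover have "- (x \<cdot> (u \<odot> v)) =
      - (\<beta> (u \<cdot> x) \<cdot> v) + (\<beta> u \<cdot> x) \<cdot> v + \<beta> (u \<cdot> x + x \<cdot> u) \<cdot> v
      - u \<cdot> (?b v \<cdot> x + x \<cdot> ?b v) + u \<cdot> ?b (v \<cdot> x + x \<cdot> v)
      - u \<cdot> \<beta> (v \<cdot> x) + u \<cdot> (\<beta> v \<cdot> x) - u \<odot> (x \<cdot> v) - (x \<cdot> u) \<odot> v"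
  proof -
    have "(\<beta> u \<cdot> x) \<cdot> v = - ((x \<cdot> \<beta> u) \<cdot> v)"
      using symmetrizer_bracket[of "\<beta> u" x v] by (simp add: eq_neg_iff_add_eq_0)
    thus ?thesis
      by (simp add: descendent_def bracket_simps beta_add scale_right_distrib
          leibniz[of x u] leibniz[of x "\<beta> u"])
  qed
  hence "- \<omega> (x \<cdot> (u \<odot> v)) y =
      - \<omega> (\<beta> (u \<cdot> x) \<cdot> v) y + \<omega> ((\<beta> u \<cdot> x) \<cdot> v) y + \<omega> (\<beta> (u \<cdot> x + x \<cdot> u) \<cdot> v) y
      - \<omega> (u \<cdot> (?b v \<cdot> x + x \<cdot> ?b v)) y + \<omega> (u \<cdot> ?b (v \<cdot> x + x \<cdot> v)) y
      - \<omega> (u \<cdot> \<beta> (v \<cdot> x)) y + \<omega> (u \<cdot> (\<beta> v \<cdot> x)) y - \<omega> (u \<odot> (x \<cdot> v)) y - \<omega> ((x \<cdot> u) \<odot> v) y"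
    by (metis form_add_left form_diff_left form_minus_left)
  ultimately show ?thesis by (simp only: form_add_left) simp
qed

lemma cobracket_compatible:
  "cobracket rmat (x \<cdot> y) =
     (map2 id (Rm y) (cobracket rmat x + flip2 (cobracket rmat x))
       - map2 (Lm y + Rm y) id (cobracket rmat x + flip2 (cobracket rmat x)))
     + (map2 id (Lm x) (cobracket rmat y) + map2 (Lm x) id (cobracket rmat y))"
proof (rule tensor2_eq_formI)
  fix u v
  \<comment> \<open>The transpose of \<open>Lm x\<close> carries a sign inside the functional, which
    has to be moved out of \<open>\<odot>\<close> before \<open>descendent_compatible\<close>
    applies.\<close>
  have minus: "p \<odot> (- q) = - (p \<odot> q)" "(- p) \<odot> q = - (p \<odot> q)" for p q
    using beta_scale[of "- 1"] bracket_scale_left[of "- 1"] bracket_scale_right[of _ "- 1"]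
    by (simp_all add: descendent_def)
  show "cobracket rmat (x \<cdot> y) (\<omega> u) (\<omega> v) =
     ((map2 id (Rm y) (cobracket rmat x + flip2 (cobracket rmat x))
       - map2 (Lm y + Rm y) id (cobracket rmat x + flip2 (cobracket rmat x)))
     + (map2 id (Lm x) (cobracket rmat y) + map2 (Lm x) id (cobracket rmat y))) (\<omega> u) (\<omega> v)"
    by (simp add: map2_apply_form flip2_def cobracket_apply minus form_minus_left form_add_left
        descendent_compatible[of u v x y])
qed (auto simp: map2_outside cobracket_outside)

text \<open>The nonzero weight enters through the skew part: its operator form is
  \<open>- lam\<close> times the inverse of \<open>sharp \<omega>\<close>, hence an
  isomorphism.\<close>

lemma factorizable_rmat:
  assumes "lam \<noteq> 0"
  shows "factorizable rmat"
  unfolding factorizable_def quasi_triangular_def leibniz_bialgebra_def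
  using clybe_rmat Fop_skew_part cobracket_linear cobracket_in_tensor2 cobracket_coleibniz
    cobracket_symmetry cobracket_compatible linear_iso_dual_scale[of "- lam"] assms
  by (auto simp: rmat_skew_part)

end

theorem theorem4p19:
  fixes scale :: "'k::{alg_closed_field, field_char_0} \<Rightarrow> 'a::ab_group_add \<Rightarrow> 'a"
    and bracket :: "'a \<Rightarrow> 'a \<Rightarrow> 'a"
    and \<omega> :: "'a \<Rightarrow> 'a \<Rightarrow> 'k"
    and \<beta> :: "'a \<Rightarrow> 'a"
    and lam :: 'k
  assumes "skew_quadratic_rota_baxter_leibniz_algebra scale bracket \<omega> \<beta> lam"
    and "lam \<noteq> 0"
  shows "\<exists>r \<in> vect.tensor2 scale.
           (\<forall>f \<in> vect.dual scale.
              vect.op_form scale r f = \<beta> (inv (sharp \<omega>) f)) \<and>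
           leibniz_algebra.factorizable scale bracket r"
proof -
  interpret skew_quadratic_rota_baxter_leibniz_algebra scale bracket \<omega> \<beta> lam by fact
  show ?thesis
    using rmat_in_tensor2 op_form_tensor_of_endo[OF beta_linear] factorizable_rmat[OF assms(2)]
    by (auto simp: rmat_def)
qed

end
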